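(* Consider the TV-ARMA($p,q$) equation with deterministic coefficients $y_t=\varphi(t)+\sum_{m=1}^{p}\phi_m(t)y_{t-m}+\varepsilon_t+\sum_{l=1}^{q}\theta_l(t)\varepsilon_{t-l}$, $t\in\mathbb{Z}$. Suppose the absolute summability condition $\sum_{r=-\infty}^{t}|\xi(t,r)|<\infty$ holds for all $t$, and that $\varphi(t)$ and $\theta_l(t)$ ($1\le l\le q$) are bounded functions of $t$. Let $y_t=\sum_{r=-\infty}^{t}\xi(t,r)\varphi(r)+\sum_{r=-\infty}^{t}\xi_q(t,r)\varepsilon_r$. Then the unconditional mean of $y_t$ exists in $\mathbb{R}$ and is given by $$\mathbb{E}(y_t)=\sum_{r=-\infty}^{t}\xi(t,r)\varphi(r).$$ The absolute summability condition is also sufficient for the existence of the unconditional variance of $y_t$, which is given by $$\operatorname{Var}(y_t)=\sum_{r=-\infty}^{t}\xi_q^2(t,r)\sigma^2(r).$$ Necessary conditions for the process $y_t$ to be second order (respectively, for the first and the second of these moments) are $$\lim_{s\to-\infty}\xi(t,s)\varphi(s)=0\quad\text{and}\quad\lim_{s\to-\infty}\xi_q^2(t,s)\sigma^2(s)=0\quad\text{for all } t.$$ Moreover, the stability condition $\lim_{s\to-\infty}\xi(t,s)=0$ (for all $t$) is sufficient for these two limit conditions to hold, due to the boundedness of $\varphi(r)$ and $\sigma^2(r)$, while it is necessary for the absolute summability condition to hold.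
   Context: Let $p,q\ge 1$ be integers. The coefficients $\varphi(t),\phi_m(t),\theta_l(t)$ are deterministic real-valued functions of $t\in\mathbb{Z}$. The errors satisfy $\mathbb{E}(\varepsilon_t)=0$, $\mathbb{E}(\varepsilon_t\varepsilon_s)=0$ for $s\ne t$, $\mathbb{E}(\varepsilon_t\mid y_s,s<t)=0$, $\mathbb{E}(\varepsilon_t^2)=\sigma^2(t)$ with $0<\sigma^2(t)\le M<\infty$ for all $t$ and some $M$. Infinite sums of random variables are understood as limits in $L_2=L_2(\Omega,\mathcal F,P)$. A process is second order if $y_t\in L_2$ for all $t$. Principal determinant: for integers $s<t$, $\xi(t,s)=\det(\mathbf{\Phi}_{t,s})$, where $\mathbf{\Phi}_{t,s}$ is the $(t-s)\times(t-s)$ matrix whose $(i,j)$ entry is $\phi_{i-j+1}(s+i)$ if $0\le i-j\le p-1$, $-1$ if $j=i+1$, and $0$ otherwise. Moreover $\xi(t,t)=1$ and $\xi(t,s)=0$ for $t<s$. Also $\xi_q(t,r)=\xi(t,r)+\sum_{l=1}^{q}\xi(t,r+l)\theta_l(r+l)$. *)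

theory Defs
  imports "HOL-Probability.Probability" "Jordan_Normal_Form.Determinant"
begin

(* Matrix indices start at 0, hence the shift by one in the time argument: row i is row i + 1
   of the usual 1-based description. The first conjunct guards the truncating subtraction. *)
definition principal_matrix :: "nat \<Rightarrow> (nat \<Rightarrow> int \<Rightarrow> real) \<Rightarrow> int \<Rightarrow> int \<Rightarrow> real mat" where
  "principal_matrix p \<phi> t s = mat (nat (t - s)) (nat (t - s))
     (\<lambda>(i, j). if j \<le> i \<and> i - j \<le> p - 1 then \<phi> (i - j + 1) (s + int i + 1)
               else if j = i + 1 then - 1 else 0)"

definition xi :: "nat \<Rightarrow> (nat \<Rightarrow> int \<Rightarrow> real) \<Rightarrow> int \<Rightarrow> int \<Rightarrow> real" where
  "xi p \<phi> t s = (if s < t then Determinant.det (principal_matrix p \<phi> t s)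
                 else if s = t then 1 else 0)"

definition xi_q ::
  "nat \<Rightarrow> nat \<Rightarrow> (nat \<Rightarrow> int \<Rightarrow> real) \<Rightarrow> (nat \<Rightarrow> int \<Rightarrow> real) \<Rightarrow> int \<Rightarrow> int \<Rightarrow> real" where
  "xi_q p q \<phi> \<theta> t r = xi p \<phi> t r + (\<Sum>l=1..q. xi p \<phi> t (r + int l) * \<theta> l (r + int l))"

(* Sums over r from minus infinity to t are limits of the sums over r = t, t - 1, ..., t - n. *)
abbreviation past_summable :: "(int \<Rightarrow> real) \<Rightarrow> int \<Rightarrow> bool" where
  "past_summable f t \<equiv> summable (\<lambda>n. f (t - int n))"

abbreviation past_sums :: "(int \<Rightarrow> real) \<Rightarrow> int \<Rightarrow> real \<Rightarrow> bool" where
  "past_sums f t S \<equiv> (\<lambda>n. f (t - int n)) sums S"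

abbreviation past_sum :: "(int \<Rightarrow> real) \<Rightarrow> int \<Rightarrow> real" where
  "past_sum f t \<equiv> (\<Sum>n. f (t - int n))"

(* Convergence in L2. The distance is an extended nonnegative integral, so for square integrable
   summands the limit is square integrable as a consequence of convergence. *)
definition L2_past_sums ::
  "'a measure \<Rightarrow> (int \<Rightarrow> 'a \<Rightarrow> real) \<Rightarrow> int \<Rightarrow> ('a \<Rightarrow> real) \<Rightarrow> bool" where
  "L2_past_sums M X t Z \<longleftrightarrow> Z \<in> borel_measurable M \<and>
     (\<lambda>n. \<integral>\<^sup>+\<omega>. ennreal (((\<Sum>k<n. X (t - int k) \<omega>) - Z \<omega>)\<^sup>2) \<partial>M) \<longlonglongrightarrow> 0"

definition past_algebra :: "'a measure \<Rightarrow> (int \<Rightarrow> 'a \<Rightarrow> real) \<Rightarrow> int \<Rightarrow> 'a measure" where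
  "past_algebra M y t =
     sigma (space M) {y s -` A \<inter> space M | s A. s < t \<and> A \<in> sets borel}"

definition errors ::
  "'a measure \<Rightarrow> (int \<Rightarrow> 'a \<Rightarrow> real) \<Rightarrow> (int \<Rightarrow> real) \<Rightarrow> (int \<Rightarrow> 'a \<Rightarrow> real) \<Rightarrow> bool" where
  "errors M y \<sigma> \<epsilon> \<longleftrightarrow>
     (\<forall>t. \<epsilon> t \<in> borel_measurable M \<and> integrable M (\<lambda>\<omega>. (\<epsilon> t \<omega>)\<^sup>2)) \<and>
     (\<forall>t. (\<integral>\<omega>. \<epsilon> t \<omega> \<partial>M) = 0) \<and>
     (\<forall>t s. s \<noteq> t \<longrightarrow> (\<integral>\<omega>. \<epsilon> t \<omega> * \<epsilon> s \<omega> \<partial>M) = 0) \<and>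
     (\<forall>t. AE \<omega> in M. real_cond_exp M (past_algebra M y t) (\<epsilon> t) \<omega> = 0) \<and>
     (\<forall>t. (\<integral>\<omega>. (\<epsilon> t \<omega>)\<^sup>2 \<partial>M) = (\<sigma> t)\<^sup>2) \<and>
     (\<exists>K. \<forall>t. 0 < (\<sigma> t)\<^sup>2 \<and> (\<sigma> t)\<^sup>2 \<le> K)"

definition tv_arma ::
  "'a measure \<Rightarrow> nat \<Rightarrow> nat \<Rightarrow> (int \<Rightarrow> real) \<Rightarrow> (nat \<Rightarrow> int \<Rightarrow> real) \<Rightarrow> (nat \<Rightarrow> int \<Rightarrow> real) \<Rightarrow>
   (int \<Rightarrow> 'a \<Rightarrow> real) \<Rightarrow> (int \<Rightarrow> 'a \<Rightarrow> real) \<Rightarrow> bool" where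
  "tv_arma M p q c \<phi> \<theta> \<epsilon> y \<longleftrightarrow>
     (\<forall>t. y t \<in> borel_measurable M) \<and>
     (\<forall>t. AE \<omega> in M. y t \<omega> = c t + (\<Sum>m=1..p. \<phi> m t * y (t - int m) \<omega>)
                            + \<epsilon> t \<omega> + (\<Sum>l=1..q. \<theta> l t * \<epsilon> (t - int l) \<omega>))"

definition has_past_representation ::
  "'a measure \<Rightarrow> nat \<Rightarrow> nat \<Rightarrow> (int \<Rightarrow> real) \<Rightarrow> (nat \<Rightarrow> int \<Rightarrow> real) \<Rightarrow> (nat \<Rightarrow> int \<Rightarrow> real) \<Rightarrow>
   (int \<Rightarrow> 'a \<Rightarrow> real) \<Rightarrow> (int \<Rightarrow> 'a \<Rightarrow> real) \<Rightarrow> bool" where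
  "has_past_representation M p q c \<phi> \<theta> \<epsilon> y \<longleftrightarrow>
     (\<forall>t. past_summable (\<lambda>r. xi p \<phi> t r * c r) t \<and>
          L2_past_sums M (\<lambda>r \<omega>. xi_q p q \<phi> \<theta> t r * \<epsilon> r \<omega>) t
            (\<lambda>\<omega>. y t \<omega> - past_sum (\<lambda>r. xi p \<phi> t r * c r) t))"

definition second_order :: "'a measure \<Rightarrow> (int \<Rightarrow> 'a \<Rightarrow> real) \<Rightarrow> bool" where
  "second_order M y \<longleftrightarrow>
     (\<forall>t. y t \<in> borel_measurable M \<and> integrable M (\<lambda>\<omega>. (y t \<omega>)\<^sup>2))"

end

(* The terms xi_q(t,r) eps_r are orthogonal in L2, so by Riesz-Fischer and Pythagoras their series
   converges in L2 iff the squares xi_q(t,r)^2 sigma(r)^2 are summable, and the moments of the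
   partial sums pass to the L2 limit. Absolute summability of xi(t,.) carries over to xi_q(t,.),
   a combination of q + 1 shifts of xi(t,.) with bounded weights, and then to the squares. The
   necessary conditions hold because the terms of a convergent series tend to zero. *)

theory Submission
  imports Defs
begin

section \<open>Cauchy-Schwarz, and the passage of first and second moments to an L2 limit\<close>

section \<open>Square integrable functions\<close>

lemma integrable_mult_of_square_integrable:
  fixes f g :: "'a \<Rightarrow> real"
  assumes [measurable]: "f \<in> borel_measurable M" "g \<in> borel_measurable M"
    and "integrable M (\<lambda>x. (f x)\<^sup>2)" "integrable M (\<lambda>x. (g x)\<^sup>2)"
  shows "integrable M (\<lambda>x. f x * g x)"
proof (rule Bochner_Integration.integrable_bound)
  show "integrable M (\<lambda>x. (f x)\<^sup>2 + (g x)\<^sup>2)" using assms by simp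
  have "\<bar>a * b\<bar> \<le> a\<^sup>2 + b\<^sup>2" for a b :: real
  proof -
    have "2 * (\<bar>a\<bar> * \<bar>b\<bar>) \<le> a\<^sup>2 + b\<^sup>2"
      using sum_squares_bound[of "\<bar>a\<bar>" "\<bar>b\<bar>"] by simp
    moreover have "0 \<le> \<bar>a\<bar> * \<bar>b\<bar>" by simp
    ultimately show ?thesis unfolding abs_mult by linarith
  qed
  then show "AE x in M. norm (f x * g x) \<le> norm ((f x)\<^sup>2 + (g x)\<^sup>2)" by simp
qed measurable

text \<open>All three integrals are finite, so the inequality for extended nonnegative integrals
  carries over to real ones. The absolute value inside the integral serves both uses below: first
  absolute moments and cross terms.\<close>

lemma Cauchy_Schwarz_integral_abs:
  fixes f g :: "'a \<Rightarrow> real"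
  assumes [measurable]: "f \<in> borel_measurable M" "g \<in> borel_measurable M"
    and f: "integrable M (\<lambda>x. (f x)\<^sup>2)" and g: "integrable M (\<lambda>x. (g x)\<^sup>2)"
  shows "(\<integral>x. \<bar>f x * g x\<bar> \<partial>M) \<le> sqrt (\<integral>x. (f x)\<^sup>2 \<partial>M) * sqrt (\<integral>x. (g x)\<^sup>2 \<partial>M)"
proof -
  have fg: "integrable M (\<lambda>x. \<bar>f x * g x\<bar>)"
    using integrable_mult_of_square_integrable[OF assms] by simp
  have eq: "(\<integral>\<^sup>+x. ennreal \<bar>f x\<bar> * ennreal \<bar>g x\<bar> \<partial>M) = ennreal (\<integral>x. \<bar>f x * g x\<bar> \<partial>M)"
    using nn_integral_eq_integral[OF fg] by (simp add: abs_mult ennreal_mult)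
  have "ennreal ((\<integral>x. \<bar>f x * g x\<bar> \<partial>M)\<^sup>2) \<le> ennreal ((\<integral>x. (f x)\<^sup>2 \<partial>M) * (\<integral>x. (g x)\<^sup>2 \<partial>M))"
    using Cauchy_Schwarz_nn_integral[of "\<lambda>x. ennreal \<bar>f x\<bar>" M "\<lambda>x. ennreal \<bar>g x\<bar>"]
    by (simp add: eq nn_integral_eq_integral[OF f] nn_integral_eq_integral[OF g] ennreal_power ennreal_mult)
  then have "(\<integral>x. \<bar>f x * g x\<bar> \<partial>M)\<^sup>2 \<le> (\<integral>x. (f x)\<^sup>2 \<partial>M) * (\<integral>x. (g x)\<^sup>2 \<partial>M)"
    by (simp add: ennreal_le_iff)
  then show ?thesis
    by (simp add: real_le_rsqrt flip: real_sqrt_mult)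
qed

text \<open>Cauchy-Schwarz against the constant 1, which has norm 1 on a probability space. Hence L2
  convergence implies L1 convergence.\<close>

lemma (in prob_space) expectation_abs_le_sqrt:
  fixes f :: "'a \<Rightarrow> real"
  assumes "f \<in> borel_measurable M" "integrable M (\<lambda>x. (f x)\<^sup>2)"
  shows "expectation (\<lambda>x. \<bar>f x\<bar>) \<le> sqrt (expectation (\<lambda>x. (f x)\<^sup>2))"
  using Cauchy_Schwarz_integral_abs[of f M "\<lambda>_. 1"] assms by (simp add: prob_space)

lemma square_integrable_diff:
  fixes f g :: "'a \<Rightarrow> real"
  assumes [measurable]: "f \<in> borel_measurable M" "g \<in> borel_measurable M"
    and "integrable M (\<lambda>x. (f x)\<^sup>2)" "integrable M (\<lambda>x. (g x)\<^sup>2)"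
  shows "integrable M (\<lambda>x. (f x - g x)\<^sup>2)"
  unfolding power2_diff using assms integrable_mult_of_square_integrable[OF assms]
  by (simp add: mult.assoc)

text \<open>\<open>S\<close> stands for the partial sums of a series. Only measurability is required
  of \<open>Z\<close>; its square integrability is derived from the convergence.\<close>

locale L2_convergent = prob_space +
  fixes S :: "nat \<Rightarrow> 'a \<Rightarrow> real" and Z :: "'a \<Rightarrow> real"
  assumes S_measurable [measurable]: "\<And>n. S n \<in> borel_measurable M"
    and S_square: "\<And>n. integrable M (\<lambda>x. (S n x)\<^sup>2)"
    and Z_measurable [measurable]: "Z \<in> borel_measurable M"
    and S_tendsto: "(\<lambda>n. \<integral>\<^sup>+x. ennreal ((S n x - Z x)\<^sup>2) \<partial>M) \<longlonglongrightarrow> 0"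
begin

lemma limit_square_integrable: "integrable M (\<lambda>x. (Z x)\<^sup>2)"
proof -
  \<comment> \<open>One index at finite distance from \<open>Z\<close> is enough; the bound 1 is an
    arbitrary finite value.\<close>
  have "eventually (\<lambda>n. (\<integral>\<^sup>+x. ennreal ((S n x - Z x)\<^sup>2) \<partial>M) < 1) sequentially"
    using S_tendsto by (rule order_tendstoD) simp
  then obtain n where "(\<integral>\<^sup>+x. ennreal ((S n x - Z x)\<^sup>2) \<partial>M) < 1"
    by (auto simp: eventually_sequentially)
  then have "(\<integral>\<^sup>+x. ennreal ((S n x - Z x)\<^sup>2) \<partial>M) < \<infinity>"
    using less_trans[OF _ ennreal_one_less_top] by (simp add: top_unique)
  then have "integrable M (\<lambda>x. (S n x - Z x)\<^sup>2)"
    by (intro integrableI_nonneg) auto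
  \<comment> \<open>Here \<open>Z\<close> is recovered as \<open>S n - (S n - Z)\<close>.\<close>
  from square_integrable_diff[OF _ _ S_square this, of n] show ?thesis by simp
qed

lemma diff_square_integrable: "integrable M (\<lambda>x. (S n x - Z x)\<^sup>2)"
  by (intro square_integrable_diff S_square limit_square_integrable) auto

lemma expectation_diff_square_tendsto: "(\<lambda>n. expectation (\<lambda>x. (S n x - Z x)\<^sup>2)) \<longlonglongrightarrow> 0"
proof -
  have "(\<lambda>n. ennreal (expectation (\<lambda>x. (S n x - Z x)\<^sup>2))) \<longlonglongrightarrow> ennreal 0"
    using S_tendsto by (simp add: nn_integral_eq_integral[OF diff_square_integrable])
  then show ?thesis by (subst (asm) tendsto_ennreal_iff) auto
qed

text \<open>The error in the mean is at most the L1 distance, which is at most the L2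
  distance.\<close>

lemma expectation_tendsto: "(\<lambda>n. expectation (S n)) \<longlonglongrightarrow> expectation Z"
proof -
  have "(\<lambda>n. expectation (S n) - expectation Z) \<longlonglongrightarrow> 0"
  proof (rule Lim_null_comparison)
    show "(\<lambda>n. sqrt (expectation (\<lambda>x. (S n x - Z x)\<^sup>2))) \<longlonglongrightarrow> 0"
      using tendsto_real_sqrt[OF expectation_diff_square_tendsto] by simp
    have "norm (expectation (S n) - expectation Z) \<le> sqrt (expectation (\<lambda>x. (S n x - Z x)\<^sup>2))" for n
    proof -
      have "expectation (S n) - expectation Z = expectation (\<lambda>x. S n x - Z x)"
        using square_integrable_imp_integrable[OF _ S_square]
          square_integrable_imp_integrable[OF _ limit_square_integrable] by simp
      also have "norm \<dots> \<le> expectation (\<lambda>x. \<bar>S n x - Z x\<bar>)"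
        using integral_norm_bound[of M "\<lambda>x. S n x - Z x"] by simp
      also have "\<dots> \<le> sqrt (expectation (\<lambda>x. (S n x - Z x)\<^sup>2))"
        by (intro expectation_abs_le_sqrt diff_square_integrable) auto
      finally show ?thesis .
    qed
    then show "\<forall>\<^sub>F n in sequentially. norm (expectation (S n) - expectation Z)
        \<le> sqrt (expectation (\<lambda>x. (S n x - Z x)\<^sup>2))" by simp
  qed
  then show ?thesis by (rule LIM_zero_cancel)
qed

text \<open>Put \<open>S n = Z + D n\<close> and expand the square. The part with \<open>D n\<close>
  squared vanishes by assumption, and the cross term vanishes by Cauchy-Schwarz because
  \<open>Z\<close> has finite norm.\<close>

lemma expectation_square_tendsto:
  "(\<lambda>n. expectation (\<lambda>x. (S n x)\<^sup>2)) \<longlonglongrightarrow> expectation (\<lambda>x. (Z x)\<^sup>2)"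
proof -
  define D where "D n x = S n x - Z x" for n x
  have [measurable]: "D n \<in> borel_measurable M" for n unfolding D_def by simp
  have D: "integrable M (\<lambda>x. (D n x)\<^sup>2)" for n
    unfolding D_def by (rule diff_square_integrable)
  have D0: "(\<lambda>n. expectation (\<lambda>x. (D n x)\<^sup>2)) \<longlonglongrightarrow> 0"
    unfolding D_def by (rule expectation_diff_square_tendsto)
  have ZD: "integrable M (\<lambda>x. Z x * D n x)" for n
    by (intro integrable_mult_of_square_integrable limit_square_integrable D) auto
  have "(\<lambda>n. expectation (\<lambda>x. Z x * D n x)) \<longlonglongrightarrow> 0"
  proof (rule Lim_null_comparison)
    show "(\<lambda>n. sqrt (expectation (\<lambda>x. (Z x)\<^sup>2)) * sqrt (expectation (\<lambda>x. (D n x)\<^sup>2))) \<longlonglongrightarrow> 0"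
      using tendsto_mult_right_zero[OF tendsto_real_sqrt[OF D0, unfolded real_sqrt_zero]] .
    have "norm (expectation (\<lambda>x. Z x * D n x))
        \<le> sqrt (expectation (\<lambda>x. (Z x)\<^sup>2)) * sqrt (expectation (\<lambda>x. (D n x)\<^sup>2))" for n
      using order_trans[OF integral_abs_bound
          Cauchy_Schwarz_integral_abs[of Z M "D n", OF _ _ limit_square_integrable D]] by simp
    then show "\<forall>\<^sub>F n in sequentially. norm (expectation (\<lambda>x. Z x * D n x))
        \<le> sqrt (expectation (\<lambda>x. (Z x)\<^sup>2)) * sqrt (expectation (\<lambda>x. (D n x)\<^sup>2))" by simp
  qed
  from tendsto_add[OF tendsto_add[OF D0 tendsto_mult_right_zero[OF this, of 2]]
      tendsto_const[of "expectation (\<lambda>x. (Z x)\<^sup>2)"]]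
  have "(\<lambda>n. expectation (\<lambda>x. (D n x)\<^sup>2) + 2 * expectation (\<lambda>x. Z x * D n x)
      + expectation (\<lambda>x. (Z x)\<^sup>2)) \<longlonglongrightarrow> expectation (\<lambda>x. (Z x)\<^sup>2)" by simp
  moreover have "expectation (\<lambda>x. (S n x)\<^sup>2) = expectation (\<lambda>x. (D n x)\<^sup>2)
      + 2 * expectation (\<lambda>x. Z x * D n x) + expectation (\<lambda>x. (Z x)\<^sup>2)" for n
  proof -
    have "expectation (\<lambda>x. (S n x)\<^sup>2) = expectation (\<lambda>x. (D n x)\<^sup>2 + 2 * (Z x * D n x) + (Z x)\<^sup>2)"
      by (intro Bochner_Integration.integral_cong refl)
        (simp add: D_def power2_eq_square algebra_simps)
    also have "\<dots> = expectation (\<lambda>x. (D n x)\<^sup>2)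
      + 2 * expectation (\<lambda>x. Z x * D n x) + expectation (\<lambda>x. (Z x)\<^sup>2)"
      using D ZD limit_square_integrable by simp
    finally show ?thesis .
  qed
  ultimately show ?thesis by simp
qed

end

section \<open>Pythagoras and Riesz-Fischer for centred orthogonal summands\<close>

section \<open>Orthogonal series\<close>

locale orthogonal_sequence = prob_space +
  fixes X :: "nat \<Rightarrow> 'a \<Rightarrow> real"
  assumes X_measurable [measurable]: "\<And>n. X n \<in> borel_measurable M"
    and X_square: "\<And>n. integrable M (\<lambda>x. (X n x)\<^sup>2)"
    and X_mean: "\<And>n. expectation (X n) = 0"
    and X_orthogonal: "\<And>m n. m \<noteq> n \<Longrightarrow> expectation (\<lambda>x. X m x * X n x) = 0"
begin

lemma product_integrable: "integrable M (\<lambda>x. X m x * X n x)"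
  by (intro integrable_mult_of_square_integrable X_square) auto

lemma sum_square_integrable: "integrable M (\<lambda>x. (\<Sum>n\<in>A. X n x)\<^sup>2)"
  unfolding power2_eq_square sum_product
  by (intro Bochner_Integration.integrable_sum product_integrable)

text \<open>Pythagoras: in the double sum from expanding the square, orthogonality removes every
  off-diagonal term.\<close>

lemma expectation_sum_square:
  assumes "finite A"
  shows "expectation (\<lambda>x. (\<Sum>n\<in>A. X n x)\<^sup>2) = (\<Sum>n\<in>A. expectation (\<lambda>x. (X n x)\<^sup>2))"
proof -
  have "expectation (\<lambda>x. (\<Sum>n\<in>A. X n x)\<^sup>2) = (\<Sum>m\<in>A. \<Sum>n\<in>A. expectation (\<lambda>x. X m x * X n x))"
    unfolding power2_eq_square sum_product
    by (simp add: Bochner_Integration.integral_sum product_integrable)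
  also have "\<dots> = (\<Sum>m\<in>A. \<Sum>n\<in>A. if m = n then expectation (\<lambda>x. (X n x)\<^sup>2) else 0)"
    by (intro sum.cong refl) (simp add: X_orthogonal power2_eq_square)
  also have "\<dots> = (\<Sum>n\<in>A. expectation (\<lambda>x. (X n x)\<^sup>2))"
    using assms by simp
  finally show ?thesis .
qed

text \<open>Every partial sum has mean 0, and by Pythagoras its second moment is a partial sum of
  the series of second moments. Both facts pass to the L2 limit, so convergence of that series is
  obtained together with its value.\<close>

lemma L2_limit:
  assumes "Z \<in> borel_measurable M"
    and "(\<lambda>n. \<integral>\<^sup>+x. ennreal (((\<Sum>k<n. X k x) - Z x)\<^sup>2) \<partial>M) \<longlonglongrightarrow> 0"
  shows "integrable M (\<lambda>x. (Z x)\<^sup>2)" and "expectation Z = 0"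
    and "(\<lambda>n. expectation (\<lambda>x. (X n x)\<^sup>2)) sums expectation (\<lambda>x. (Z x)\<^sup>2)"
proof -
  interpret L: L2_convergent M "\<lambda>n x. \<Sum>k<n. X k x" Z
    using assms by unfold_locales (auto intro: sum_square_integrable)
  show "integrable M (\<lambda>x. (Z x)\<^sup>2)" by (rule L.limit_square_integrable)
  have "expectation (\<lambda>x. \<Sum>k<n. X k x) = 0" for n
    using square_integrable_imp_integrable[OF X_measurable X_square]
    by (simp add: Bochner_Integration.integral_sum X_mean)
  then show "expectation Z = 0"
    using L.expectation_tendsto by (simp add: LIMSEQ_const_iff)
  show "(\<lambda>n. expectation (\<lambda>x. (X n x)\<^sup>2)) sums expectation (\<lambda>x. (Z x)\<^sup>2)"
    using L.expectation_square_tendsto by (simp add: sums_def expectation_sum_square)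
qed

lemma expectation_diff_square_partial_sums:
  assumes "m \<le> n"
  shows "expectation (\<lambda>x. ((\<Sum>k<n. X k x) - (\<Sum>k<m. X k x))\<^sup>2)
    = (\<Sum>k=m..<n. expectation (\<lambda>x. (X k x)\<^sup>2))"
proof -
  have "(\<Sum>k<n. X k x) - (\<Sum>k<m. X k x) = (\<Sum>k=m..<n. X k x)" for x
    using sum_diff_nat_ivl[of 0 m n "\<lambda>k. X k x"] assms by (simp add: atLeast0LessThan)
  then show ?thesis by (simp add: expectation_sum_square)
qed

text \<open>The squared distance of two partial sums is a block of the numerical series, so the
  Cauchy criterion carries over.\<close>

lemma partial_sums_L2_Cauchy:
  assumes "summable (\<lambda>n. expectation (\<lambda>x. (X n x)\<^sup>2))" and "0 < e"
  obtains N where "\<And>m n. N \<le> m \<Longrightarrow> N \<le> n \<Longrightarrow>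
    expectation (\<lambda>x. ((\<Sum>k<m. X k x) - (\<Sum>k<n. X k x))\<^sup>2) < e"
proof -
  obtain N where N: "\<And>m n. N \<le> m \<Longrightarrow> norm (\<Sum>k=m..<n. expectation (\<lambda>x. (X k x)\<^sup>2)) < e"
    using assms unfolding summable_Cauchy by blast
  show ?thesis
  proof (rule that[of N])
    fix m n assume "N \<le> m" "N \<le> n"
    then show "expectation (\<lambda>x. ((\<Sum>k<m. X k x) - (\<Sum>k<n. X k x))\<^sup>2) < e"
      \<comment> \<open>The indices may come in either order; the square is symmetric in
        them.\<close>
      using N[of m n] N[of n m] expectation_diff_square_partial_sums[of m n]
        expectation_diff_square_partial_sums[of n m]
      by (cases "m \<le> n") (simp_all add: power2_commute)
  qed
qed

text \<open>The Riesz-Fischer argument. The partial sums are Cauchy in L2, hence in L1, so a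
  subsequence is Cauchy almost everywhere. Its pointwise limit is the candidate, and Fatou's lemma
  yields L2 convergence of the whole sequence.\<close>

lemma L2_series_converges:
  assumes "summable (\<lambda>n. expectation (\<lambda>x. (X n x)\<^sup>2))"
  obtains Z where "Z \<in> borel_measurable M"
    and "(\<lambda>n. \<integral>\<^sup>+x. ennreal (((\<Sum>k<n. X k x) - Z x)\<^sup>2) \<partial>M) \<longlonglongrightarrow> 0"
proof -
  define S where "S n x = (\<Sum>k<n. X k x)" for n x
  have [measurable]: "S n \<in> borel_measurable M" for n unfolding S_def by simp
  have S_square: "integrable M (\<lambda>x. (S n x)\<^sup>2)" for n
    unfolding S_def by (rule sum_square_integrable)
  have diff_square: "integrable M (\<lambda>x. (S m x - S n x)\<^sup>2)" for m n
    by (intro square_integrable_diff S_square) auto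
  have Cauchy_S: "\<exists>N. \<forall>m\<ge>N. \<forall>n\<ge>N. expectation (\<lambda>x. (S m x - S n x)\<^sup>2) < e" if "0 < e" for e
    using partial_sums_L2_Cauchy[OF assms that] unfolding S_def by metis
  obtain r where r: "strict_mono r" "AE x in M. Cauchy (\<lambda>i. S (r i) x)"
  proof (rule cauchy_L1_AE_cauchy_subseq[of M S])
    show "integrable M (S n)" for n
      using square_integrable_imp_integrable[OF _ S_square] by simp
    fix e :: real assume "0 < e"
    \<comment> \<open>The threshold is the square of \<open>e\<close> because the L1 distance is
      bounded by the root of the squared L2 distance.\<close>
    then obtain N where N: "\<And>m n. N \<le> m \<Longrightarrow> N \<le> n \<Longrightarrow> expectation (\<lambda>x. (S m x - S n x)\<^sup>2) < e\<^sup>2"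
      using Cauchy_S[of "e\<^sup>2"] by auto
    have "expectation (\<lambda>x. \<bar>S m x - S n x\<bar>) < e" if "N \<le> m" "N \<le> n" for m n
    proof -
      have "expectation (\<lambda>x. \<bar>S m x - S n x\<bar>) \<le> sqrt (expectation (\<lambda>x. (S m x - S n x)\<^sup>2))"
        by (intro expectation_abs_le_sqrt diff_square) auto
      also have "\<dots> < e"
        using N[OF that] \<open>0 < e\<close> by (simp add: real_less_lsqrt)
      finally show ?thesis .
    qed
    then show "\<exists>N. \<forall>i\<ge>N. \<forall>j\<ge>N. expectation (\<lambda>x. norm (S i x - S j x)) < e" by auto
  qed
  \<comment> \<open>Where the subsequence diverges, which happens only on a null set,
    \<open>lim\<close> takes an unspecified value; \<open>Z\<close> is still measurable on the whole
    space.\<close>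
  define Z where "Z x = lim (\<lambda>i. S (r i) x)" for x
  have Z [measurable]: "Z \<in> borel_measurable M" unfolding Z_def by measurable
  have "(\<lambda>n. \<integral>\<^sup>+x. ennreal ((S n x - Z x)\<^sup>2) \<partial>M) \<longlonglongrightarrow> 0"
  proof (rule tendsto_zero_ennreal)
    fix e :: real assume "0 < e"
    \<comment> \<open>Half of \<open>e\<close>, since the limit keeps only a weak inequality while a
      strict one is wanted.\<close>
    then obtain N where N: "\<And>m n. N \<le> m \<Longrightarrow> N \<le> n \<Longrightarrow> expectation (\<lambda>x. (S m x - S n x)\<^sup>2) < e / 2"
      using Cauchy_S[of "e / 2"] by auto
    have "(\<integral>\<^sup>+x. ennreal ((S n x - Z x)\<^sup>2) \<partial>M) < ennreal e" if "N \<le> n" for n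
    proof -
      have lim: "AE x in M. ennreal ((S n x - Z x)\<^sup>2) = liminf (\<lambda>i. ennreal ((S n x - S (r i) x)\<^sup>2))"
        using r(2)
      proof eventually_elim
        fix x assume "Cauchy (\<lambda>i. S (r i) x)"
        then have "(\<lambda>i. S (r i) x) \<longlonglongrightarrow> Z x"
          unfolding Z_def by (simp add: Cauchy_convergent convergent_LIMSEQ_iff[symmetric])
        then have "(\<lambda>i. ennreal ((S n x - S (r i) x)\<^sup>2)) \<longlonglongrightarrow> ennreal ((S n x - Z x)\<^sup>2)"
          by (intro tendsto_intros)
        then show "ennreal ((S n x - Z x)\<^sup>2) = liminf (\<lambda>i. ennreal ((S n x - S (r i) x)\<^sup>2))"
          by (rule lim_imp_Liminf[OF trivial_limit_sequentially, symmetric])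
      qed
      have "(\<integral>\<^sup>+x. ennreal ((S n x - Z x)\<^sup>2) \<partial>M)
          = (\<integral>\<^sup>+x. liminf (\<lambda>i. ennreal ((S n x - S (r i) x)\<^sup>2)) \<partial>M)"
        by (rule nn_integral_cong_AE[OF lim])
      \<comment> \<open>Fatou's lemma along the subsequence, with \<open>n\<close> held
        fixed.\<close>
      also have "\<dots> \<le> liminf (\<lambda>i. \<integral>\<^sup>+x. ennreal ((S n x - S (r i) x)\<^sup>2) \<partial>M)"
        by (intro nn_integral_liminf) measurable
      \<comment> \<open>An upper bound that holds for all large \<open>i\<close> bounds the limsup
        directly.\<close>
      also have "\<dots> \<le> limsup (\<lambda>i. \<integral>\<^sup>+x. ennreal ((S n x - S (r i) x)\<^sup>2) \<partial>M)"
        by (intro Liminf_le_Limsup sequentially_bot)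
      also have "\<dots> \<le> ennreal (e / 2)"
      proof (rule Limsup_bounded)
        show "\<forall>\<^sub>F i in sequentially. (\<integral>\<^sup>+x. ennreal ((S n x - S (r i) x)\<^sup>2) \<partial>M) \<le> ennreal (e / 2)"
          using eventually_ge_at_top[of N]
        proof eventually_elim
          fix i assume "N \<le> i"
          then have "N \<le> r i" using seq_suble[OF r(1), of i] by simp
          then have "expectation (\<lambda>x. (S n x - S (r i) x)\<^sup>2) \<le> e / 2"
            using N[OF \<open>N \<le> n\<close>, of "r i"] by simp
          then show "(\<integral>\<^sup>+x. ennreal ((S n x - S (r i) x)\<^sup>2) \<partial>M) \<le> ennreal (e / 2)"
            by (simp add: nn_integral_eq_integral[OF diff_square] ennreal_leI)
        qed
      qed
      also have "\<dots> < ennreal e" using \<open>0 < e\<close> by (simp add: ennreal_less_iff)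
      finally show ?thesis .
    qed
    then show "\<forall>\<^sub>F n in sequentially. (\<integral>\<^sup>+x. ennreal ((S n x - Z x)\<^sup>2) \<partial>M) < ennreal e"
      by (auto simp: eventually_sequentially)
  qed
  then show ?thesis using that[OF Z] by (simp add: S_def)
qed

end

section \<open>Limits at minus infinity, and the inheritance of summability and decay from
  \<open>xi\<close> to \<open>xi_q\<close>\<close>

section \<open>Sums over the past\<close>

text \<open>As \<open>n\<close> grows, \<open>t - int n\<close> runs through all integers up to
  \<open>t\<close>, so the filter at minus infinity and the sequence carry the same information. The
  base point \<open>t\<close> is arbitrary.\<close>

lemma tendsto_at_bot_iff_past:
  "(f \<longlongrightarrow> l) at_bot \<longleftrightarrow> (\<lambda>n. f (t - int n)) \<longlonglongrightarrow> l"
proof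
  have "filterlim (\<lambda>n. t - int n) at_bot sequentially"
    unfolding filterlim_at_bot
  proof
    fix z
    have "t - int n \<le> z" if "nat (t - z) \<le> n" for n using that by linarith
    then show "\<forall>\<^sub>F n in sequentially. t - int n \<le> z"
      by (auto simp: eventually_sequentially)
  qed
  then show "(\<lambda>n. f (t - int n)) \<longlonglongrightarrow> l" if "(f \<longlongrightarrow> l) at_bot"
    using that by (rule filterlim_compose[rotated])
next
  assume lim: "(\<lambda>n. f (t - int n)) \<longlonglongrightarrow> l"
  have "filterlim (\<lambda>s. nat (t - s)) sequentially at_bot"
    unfolding filterlim_at_top
  proof
    fix N
    have "N \<le> nat (t - s)" if "s \<le> t - int N" for s using that by linarith
    then show "\<forall>\<^sub>F s in at_bot. N \<le> nat (t - s)"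
      unfolding eventually_at_bot_linorder by blast
  qed
  from filterlim_compose[OF lim this]
  have "((\<lambda>s. f (t - int (nat (t - s)))) \<longlongrightarrow> l) at_bot" .
  \<comment> \<open>\<open>nat\<close> truncates for \<open>s\<close> above \<open>t\<close>, so the
    two sides are compared only for \<open>s \<le> t\<close>.\<close>
  moreover have "\<forall>\<^sub>F s in at_bot. f (t - int (nat (t - s))) = f s"
    using eventually_le_at_bot[of t] by eventually_elim simp
  ultimately show "(f \<longlongrightarrow> l) at_bot" by (rule Lim_transform_eventually)
qed

lemma past_summable_tendsto_zero:
  assumes "past_summable f t"
  shows "(f \<longlongrightarrow> 0) at_bot"
  using summable_LIMSEQ_zero[OF assms] by (simp add: tendsto_at_bot_iff_past[where t = t])

text \<open>The shifted sum starts at \<open>t + l\<close> instead of \<open>t\<close>: it has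
  \<open>l\<close> additional leading terms, and finitely many terms do not affect
  summability.\<close>

lemma past_summable_shift:
  assumes "past_summable f t"
  shows "past_summable (\<lambda>r. f (r + int l)) t"
proof -
  have "summable (\<lambda>n. f (t - int (n + l) + int l))"
    using assms by (simp add: algebra_simps)
  then show ?thesis by (rule summable_iff_shift[THEN iffD1])
qed

text \<open>Shifting the argument by \<open>k\<close> amounts to moving the base point from
  \<open>t\<close> to \<open>t + k\<close>.\<close>

lemma tendsto_at_bot_shift:
  fixes f :: "int \<Rightarrow> real"
  assumes "(f \<longlongrightarrow> L) at_bot"
  shows "((\<lambda>r. f (r + k)) \<longlongrightarrow> L) at_bot"
proof -
  have "(\<lambda>n. f (t - int n + k)) \<longlonglongrightarrow> L" for t
    using assms[unfolded tendsto_at_bot_iff_past[where t = "t + k"]] by (simp add: algebra_simps)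
  then show ?thesis unfolding tendsto_at_bot_iff_past[where t = 0] .
qed

lemma bounded_mult_tendsto_zero:
  fixes f g :: "int \<Rightarrow> real"
  assumes "(f \<longlongrightarrow> 0) at_bot" and "bounded (range g)"
  shows "((\<lambda>r. f r * g r) \<longlongrightarrow> 0) at_bot"
proof -
  obtain B where "\<And>r. norm (g r) \<le> B" using assms(2) by (auto simp: bounded_iff)
  then show ?thesis by (intro lim_null_mult_right_bounded[OF assms(1), of g B]) auto
qed

lemma past_summable_bounded_mult:
  assumes "past_summable (\<lambda>r. \<bar>f r\<bar>) t" and "bounded (range g)"
  shows "past_summable (\<lambda>r. \<bar>f r * g r\<bar>) t"
proof -
  obtain B where B: "\<And>r. norm (g r) \<le> B" using assms(2) by (auto simp: bounded_iff)
  show ?thesis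
  proof (rule summable_comparison_test')
    show "summable (\<lambda>n. \<bar>f (t - int n)\<bar> * B)" by (intro summable_mult2 assms)
    show "norm \<bar>f (t - int n) * g (t - int n)\<bar> \<le> \<bar>f (t - int n)\<bar> * B" if "0 \<le> n" for n
      using B[of "t - int n"] by (simp add: abs_mult mult_left_mono)
  qed
qed

text \<open>The terms are eventually below 1 in absolute value, and from there on each square is
  dominated by the absolute value.\<close>

lemma summable_square_of_summable_abs:
  fixes a :: "nat \<Rightarrow> real"
  assumes "summable (\<lambda>n. \<bar>a n\<bar>)"
  shows "summable (\<lambda>n. (a n)\<^sup>2)"
proof -
  have "eventually (\<lambda>n. \<bar>a n\<bar> < 1) sequentially"
    using summable_LIMSEQ_zero[OF assms] by (rule order_tendstoD) simp
  then have "eventually (\<lambda>n. norm ((a n)\<^sup>2) \<le> \<bar>a n\<bar>) sequentially"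
  proof eventually_elim
    fix n assume "\<bar>a n\<bar> < 1"
    then have "\<bar>a n\<bar> * \<bar>a n\<bar> \<le> \<bar>a n\<bar>" by (intro mult_left_le) auto
    then show "norm ((a n)\<^sup>2) \<le> \<bar>a n\<bar>" by (simp add: power2_eq_square flip: abs_mult)
  qed
  then show ?thesis by (rule summable_comparison_test_ev) (rule assms)
qed

text \<open>\<open>xi_q\<close> adds to \<open>xi\<close> its first \<open>q\<close> forward shifts
  with bounded weights; each piece is absolutely summable, and the triangle inequality gives a
  summable majorant.\<close>

lemma xi_q_past_summable:
  assumes xi: "past_summable (\<lambda>r. \<bar>xi p \<phi> t r\<bar>) t" and \<theta>: "\<forall>l\<in>{1..q}. bounded (range (\<theta> l))"
  shows "past_summable (\<lambda>r. \<bar>xi_q p q \<phi> \<theta> t r\<bar>) t"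
proof (rule summable_comparison_test')
  have "past_summable (\<lambda>r. \<bar>xi p \<phi> t (r + int l) * \<theta> l (r + int l)\<bar>) t" if "l \<in> {1..q}" for l
    using past_summable_shift[OF past_summable_bounded_mult[OF xi, of "\<theta> l"], of l] \<theta> that by simp
  then show "past_summable
      (\<lambda>r. \<bar>xi p \<phi> t r\<bar> + (\<Sum>l=1..q. \<bar>xi p \<phi> t (r + int l) * \<theta> l (r + int l)\<bar>)) t"
    by (intro summable_add xi summable_sum) auto
  show "norm \<bar>xi_q p q \<phi> \<theta> t (t - int n)\<bar> \<le> \<bar>xi p \<phi> t (t - int n)\<bar>
      + (\<Sum>l=1..q. \<bar>xi p \<phi> t (t - int n + int l) * \<theta> l (t - int n + int l)\<bar>)" if "0 \<le> n" for n
    unfolding xi_q_def real_norm_def abs_idempotent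
    by (rule order_trans[OF abs_triangle_ineq]) (simp add: sum_abs)
qed

text \<open>The same decomposition, now with limits: a finite sum of shifted null functions times
  bounded weights.\<close>

lemma xi_q_tendsto_zero:
  assumes xi: "(xi p \<phi> t \<longlongrightarrow> 0) at_bot" and \<theta>: "\<forall>l\<in>{1..q}. bounded (range (\<theta> l))"
  shows "(xi_q p q \<phi> \<theta> t \<longlongrightarrow> 0) at_bot"
proof -
  have "((\<lambda>r. xi p \<phi> t (r + int l) * \<theta> l (r + int l)) \<longlongrightarrow> 0) at_bot" if "l \<in> {1..q}" for l
    using tendsto_at_bot_shift[OF bounded_mult_tendsto_zero[OF xi]] \<theta> that by blast
  then have "((\<lambda>r. xi p \<phi> t r + (\<Sum>l=1..q. xi p \<phi> t (r + int l) * \<theta> l (r + int l)))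
      \<longlongrightarrow> 0 + (\<Sum>l=1..q. 0)) at_bot"
    by (intro tendsto_add xi tendsto_sum)
  then show ?thesis by (simp add: xi_q_def[abs_def])
qed

section \<open>Weighted error series, their moments, and the proposition itself\<close>

section \<open>Moments of the past representation\<close>

lemma errors_variance_bounded:
  assumes "errors M y \<sigma> \<epsilon>"
  shows "bounded (range (\<lambda>t. (\<sigma> t)\<^sup>2))"
  using assms unfolding errors_def bounded_iff by auto

text \<open>Deterministic weights factor out of expectations and so preserve zero mean and
  orthogonality. They are left general here; later they are the values of \<open>xi_q\<close> for a
  fixed \<open>t\<close>.\<close>

lemma orthogonal_sequence_weighted_errors:
  assumes "prob_space M" and e: "errors M y \<sigma> \<epsilon>"
  shows "orthogonal_sequence M (\<lambda>n \<omega>. a n * \<epsilon> (t - int n) \<omega>)"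
proof -
  interpret prob_space M by fact
  have e_measurable: "\<epsilon> r \<in> borel_measurable M" and e_square: "integrable M (\<lambda>\<omega>. (\<epsilon> r \<omega>)\<^sup>2)"
    and e_mean: "expectation (\<epsilon> r) = 0" for r
    using e unfolding errors_def by auto
  have e_orthogonal: "expectation (\<lambda>\<omega>. \<epsilon> r \<omega> * \<epsilon> s \<omega>) = 0" if "s \<noteq> r" for r s
    using e that unfolding errors_def by blast
  show ?thesis
  proof unfold_locales
    fix m n :: nat
    show "(\<lambda>\<omega>. a n * \<epsilon> (t - int n) \<omega>) \<in> borel_measurable M"
      using e_measurable by measurable
    show "integrable M (\<lambda>\<omega>. (a n * \<epsilon> (t - int n) \<omega>)\<^sup>2)"
      using e_square by (simp add: power_mult_distrib)
    show "expectation (\<lambda>\<omega>. a n * \<epsilon> (t - int n) \<omega>) = 0"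
      using e_mean by simp
    assume "m \<noteq> n"
    have "expectation (\<lambda>\<omega>. a m * \<epsilon> (t - int m) \<omega> * (a n * \<epsilon> (t - int n) \<omega>))
        = expectation (\<lambda>\<omega>. (a m * a n) * (\<epsilon> (t - int m) \<omega> * \<epsilon> (t - int n) \<omega>))"
      by (intro Bochner_Integration.integral_cong refl) (simp only: mult_ac)
    also have "\<dots> = 0"
      using e_orthogonal[of "t - int n" "t - int m"] \<open>m \<noteq> n\<close> by simp
    finally show "expectation (\<lambda>\<omega>. a m * \<epsilon> (t - int m) \<omega> * (a n * \<epsilon> (t - int n) \<omega>)) = 0" .
  qed
qed

lemma expectation_weighted_error_square:
  assumes "errors M y \<sigma> \<epsilon>"
  shows "(\<integral>\<omega>. (b * \<epsilon> r \<omega>)\<^sup>2 \<partial>M) = b\<^sup>2 * (\<sigma> r)\<^sup>2"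
  using assms unfolding errors_def by (simp add: power_mult_distrib)

lemma L2_past_sums_weighted_errors:
  assumes "prob_space M" and "errors M y \<sigma> \<epsilon>"
    and "L2_past_sums M (\<lambda>r \<omega>. b r * \<epsilon> r \<omega>) t Z"
  shows "integrable M (\<lambda>\<omega>. (Z \<omega>)\<^sup>2)" and "(\<integral>\<omega>. Z \<omega> \<partial>M) = 0"
    and "past_sums (\<lambda>r. (b r)\<^sup>2 * (\<sigma> r)\<^sup>2) t (\<integral>\<omega>. (Z \<omega>)\<^sup>2 \<partial>M)"
proof -
  interpret orthogonal_sequence M "\<lambda>n \<omega>. b (t - int n) * \<epsilon> (t - int n) \<omega>"
    using assms(1,2) by (rule orthogonal_sequence_weighted_errors)
  have Z: "Z \<in> borel_measurable M"
    "(\<lambda>n. \<integral>\<^sup>+\<omega>. ennreal (((\<Sum>k<n. b (t - int k) * \<epsilon> (t - int k) \<omega>) - Z \<omega>)\<^sup>2) \<partial>M) \<longlonglongrightarrow> 0"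
    using assms(3) unfolding L2_past_sums_def by auto
  show "integrable M (\<lambda>\<omega>. (Z \<omega>)\<^sup>2)" and "(\<integral>\<omega>. Z \<omega> \<partial>M) = 0"
    and "past_sums (\<lambda>r. (b r)\<^sup>2 * (\<sigma> r)\<^sup>2) t (\<integral>\<omega>. (Z \<omega>)\<^sup>2 \<partial>M)"
    using L2_limit[OF Z] by (simp_all add: expectation_weighted_error_square[OF assms(2)])
qed

text \<open>Riesz-Fischer for the errors. Together with the preceding lemma, L2 convergence is
  equivalent to summability of the variances of the terms.\<close>

lemma L2_past_sums_weighted_errors_exists:
  assumes "prob_space M" and "errors M y \<sigma> \<epsilon>"
    and "past_summable (\<lambda>r. (b r)\<^sup>2 * (\<sigma> r)\<^sup>2) t"
  shows "\<exists>Z. L2_past_sums M (\<lambda>r \<omega>. b r * \<epsilon> r \<omega>) t Z"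
proof -
  interpret orthogonal_sequence M "\<lambda>n \<omega>. b (t - int n) * \<epsilon> (t - int n) \<omega>"
    using assms(1,2) by (rule orthogonal_sequence_weighted_errors)
  have "summable (\<lambda>n. expectation (\<lambda>\<omega>. (b (t - int n) * \<epsilon> (t - int n) \<omega>)\<^sup>2))"
    using assms(3) by (simp add: expectation_weighted_error_square[OF assms(2)])
  from L2_series_converges[OF this] show ?thesis
    unfolding L2_past_sums_def by blast
qed

text \<open>The variances of the terms form a convergent series, so they tend to zero.\<close>

lemma L2_past_sums_terms_tendsto_zero:
  assumes "prob_space M" and "errors M y \<sigma> \<epsilon>"
    and "L2_past_sums M (\<lambda>r \<omega>. b r * \<epsilon> r \<omega>) t Z"
  shows "((\<lambda>s. (b s)\<^sup>2 * (\<sigma> s)\<^sup>2) \<longlongrightarrow> 0) at_bot"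
  using L2_past_sums_weighted_errors(3)[OF assms]
  by (intro past_summable_tendsto_zero[of _ t]) (rule sums_summable)

text \<open>With \<open>m\<close> the deterministic sum, the representation makes
  \<open>y t - m\<close> an L2 limit of weighted error sums. Its mean 0 identifies \<open>m\<close>
  as the expectation of \<open>y t\<close>, and then its second moment is the variance.\<close>

lemma past_representation_moments:
  assumes "prob_space M" and "errors M y \<sigma> \<epsilon>" and [measurable]: "y t \<in> borel_measurable M"
    and "has_past_representation M p q c \<phi> \<theta> \<epsilon> y"
  shows "integrable M (y t)"
    and "past_sums (\<lambda>r. xi p \<phi> t r * c r) t (prob_space.expectation M (y t))"
    and "integrable M (\<lambda>\<omega>. (y t \<omega>)\<^sup>2)"
    and "past_sums (\<lambda>r. (xi_q p q \<phi> \<theta> t r)\<^sup>2 * (\<sigma> r)\<^sup>2) t (prob_space.variance M (y t))"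
proof -
  interpret prob_space M by fact
  define m where "m = past_sum (\<lambda>r. xi p \<phi> t r * c r) t"
  have sm: "past_sums (\<lambda>r. xi p \<phi> t r * c r) t m"
    using assms(4) unfolding has_past_representation_def m_def by (blast intro: summable_sums)
  have "L2_past_sums M (\<lambda>r \<omega>. xi_q p q \<phi> \<theta> t r * \<epsilon> r \<omega>) t (\<lambda>\<omega>. y t \<omega> - m)"
    using assms(4) unfolding has_past_representation_def m_def by blast
  note W = L2_past_sums_weighted_errors[OF assms(1,2) this]
  have Wi: "integrable M (\<lambda>\<omega>. y t \<omega> - m)"
    using square_integrable_imp_integrable[OF _ W(1)] by simp
  have "integrable M (\<lambda>\<omega>. (y t \<omega> - m) + m)" using Wi by (rule Bochner_Integration.integrable_add) simp
  then show int: "integrable M (y t)" by simp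
  then have m: "expectation (y t) = m" using W(2) by (simp add: prob_space)
  then show "past_sums (\<lambda>r. xi p \<phi> t r * c r) t (expectation (y t))" using sm by simp
  \<comment> \<open>Subtracting the constant \<open>- m\<close> from \<open>y t - m\<close> gives
    back \<open>y t\<close>.\<close>
  from square_integrable_diff[OF _ _ W(1), of "\<lambda>_. - m"]
  show "integrable M (\<lambda>\<omega>. (y t \<omega>)\<^sup>2)" by simp
  show "past_sums (\<lambda>r. (xi_q p q \<phi> \<theta> t r)\<^sup>2 * (\<sigma> r)\<^sup>2) t (variance (y t))"
    using W(3) by (simp add: m)
qed

text \<open>Convergence of both series is a separate conclusion, so the right-hand side defining
  \<open>y\<close> is shown to exist before its moments are computed. The necessary limits appear
  jointly for a second order process and then singly, one for the series of the mean and one for the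
  series of the errors.\<close>

theorem proposition3:
  fixes M :: "'a measure" and p q :: nat
    and c \<sigma> :: "int \<Rightarrow> real" and \<phi> \<theta> :: "nat \<Rightarrow> int \<Rightarrow> real"
    and \<epsilon> y :: "int \<Rightarrow> 'a \<Rightarrow> real"
  assumes "prob_space M" and "1 \<le> p" and "1 \<le> q"
    and "errors M y \<sigma> \<epsilon>"
    and "tv_arma M p q c \<phi> \<theta> \<epsilon> y"
  shows
    "((\<forall>t. past_summable (\<lambda>r. \<bar>xi p \<phi> t r\<bar>) t) \<and>
      bounded (range c) \<and> (\<forall>l\<in>{1..q}. bounded (range (\<theta> l)))
      \<longrightarrow>
        (\<forall>t. past_summable (\<lambda>r. xi p \<phi> t r * c r) t \<and>
             (\<exists>Z. L2_past_sums M (\<lambda>r \<omega>. xi_q p q \<phi> \<theta> t r * \<epsilon> r \<omega>) t Z)) \<and>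
        (has_past_representation M p q c \<phi> \<theta> \<epsilon> y \<longrightarrow>
          (\<forall>t. integrable M (y t) \<and>
               past_sums (\<lambda>r. xi p \<phi> t r * c r) t (prob_space.expectation M (y t)) \<and>
               integrable M (\<lambda>\<omega>. (y t \<omega>)\<^sup>2) \<and>
               past_sums (\<lambda>r. (xi_q p q \<phi> \<theta> t r)\<^sup>2 * (\<sigma> r)\<^sup>2) t (prob_space.variance M (y t)))))
     \<and>
     (has_past_representation M p q c \<phi> \<theta> \<epsilon> y \<and> second_order M y \<longrightarrow>
        (\<forall>t. ((\<lambda>s. xi p \<phi> t s * c s) \<longlongrightarrow> 0) at_bot \<and>
             ((\<lambda>s. (xi_q p q \<phi> \<theta> t s)\<^sup>2 * (\<sigma> s)\<^sup>2) \<longlongrightarrow> 0) at_bot))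
     \<and>
     ((\<forall>t. past_summable (\<lambda>r. xi p \<phi> t r * c r) t) \<longrightarrow>
        (\<forall>t. ((\<lambda>s. xi p \<phi> t s * c s) \<longlongrightarrow> 0) at_bot))
     \<and>
     ((\<forall>t. \<exists>Z. L2_past_sums M (\<lambda>r \<omega>. xi_q p q \<phi> \<theta> t r * \<epsilon> r \<omega>) t Z) \<longrightarrow>
        (\<forall>t. ((\<lambda>s. (xi_q p q \<phi> \<theta> t s)\<^sup>2 * (\<sigma> s)\<^sup>2) \<longlongrightarrow> 0) at_bot))
     \<and>
     (bounded (range c) \<and> (\<forall>l\<in>{1..q}. bounded (range (\<theta> l))) \<and>
      (\<forall>t. ((\<lambda>s. xi p \<phi> t s) \<longlongrightarrow> 0) at_bot)
      \<longrightarrow>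
        (\<forall>t. ((\<lambda>s. xi p \<phi> t s * c s) \<longlongrightarrow> 0) at_bot \<and>
             ((\<lambda>s. (xi_q p q \<phi> \<theta> t s)\<^sup>2 * (\<sigma> s)\<^sup>2) \<longlongrightarrow> 0) at_bot))
     \<and>
     ((\<forall>t. past_summable (\<lambda>r. \<bar>xi p \<phi> t r\<bar>) t) \<longrightarrow>
        (\<forall>t. ((\<lambda>s. xi p \<phi> t s) \<longlongrightarrow> 0) at_bot))"
proof -
  interpret prob_space M by fact
  note e = \<open>errors M y \<sigma> \<epsilon>\<close>
  have y: "y t \<in> borel_measurable M" for t
    using \<open>tv_arma M p q c \<phi> \<theta> \<epsilon> y\<close> unfolding tv_arma_def by blast
  note terms_tendsto_zero = L2_past_sums_terms_tendsto_zero[OF \<open>prob_space M\<close> e]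
  \<comment> \<open>Absolute summability passes from \<open>xi\<close> to \<open>xi_q\<close>, then
    to the squares, and survives multiplication by the bounded variances.\<close>
  have exists: "\<exists>Z. L2_past_sums M (\<lambda>r \<omega>. xi_q p q \<phi> \<theta> t r * \<epsilon> r \<omega>) t Z"
    if "past_summable (\<lambda>r. \<bar>xi p \<phi> t r\<bar>) t" "\<forall>l\<in>{1..q}. bounded (range (\<theta> l))" for t
  proof (rule L2_past_sums_weighted_errors_exists[OF \<open>prob_space M\<close> e])
    have "past_summable (\<lambda>r. \<bar>(xi_q p q \<phi> \<theta> t r)\<^sup>2\<bar>) t"
      using summable_square_of_summable_abs[OF xi_q_past_summable[OF that]] by simp
    from past_summable_bounded_mult[OF this errors_variance_bounded[OF e]]
    show "past_summable (\<lambda>r. (xi_q p q \<phi> \<theta> t r)\<^sup>2 * (\<sigma> r)\<^sup>2) t" by simp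
  qed
  show ?thesis
  proof (intro conjI impI allI)
    fix t
    assume "(\<forall>t. past_summable (\<lambda>r. \<bar>xi p \<phi> t r\<bar>) t) \<and>
      bounded (range c) \<and> (\<forall>l\<in>{1..q}. bounded (range (\<theta> l)))"
    then have xi: "past_summable (\<lambda>r. \<bar>xi p \<phi> t r\<bar>) t"
      and c: "bounded (range c)" and \<theta>: "\<forall>l\<in>{1..q}. bounded (range (\<theta> l))" by blast+
    show "past_summable (\<lambda>r. xi p \<phi> t r * c r) t"
      using past_summable_bounded_mult[OF xi c] by (rule summable_rabs_cancel)
    show "\<exists>Z. L2_past_sums M (\<lambda>r \<omega>. xi_q p q \<phi> \<theta> t r * \<epsilon> r \<omega>) t Z"
      using exists[OF xi \<theta>] .
  next
    fix t
    assume "has_past_representation M p q c \<phi> \<theta> \<epsilon> y"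
    note past_representation_moments[OF \<open>prob_space M\<close> e y this]
    then show "integrable M (y t)"
      and "past_sums (\<lambda>r. xi p \<phi> t r * c r) t (expectation (y t))"
      and "integrable M (\<lambda>\<omega>. (y t \<omega>)\<^sup>2)"
      and "past_sums (\<lambda>r. (xi_q p q \<phi> \<theta> t r)\<^sup>2 * (\<sigma> r)\<^sup>2) t (variance (y t))"
      by blast+
  next
    fix t
    assume "has_past_representation M p q c \<phi> \<theta> \<epsilon> y \<and> second_order M y"
    then have xi: "past_summable (\<lambda>r. xi p \<phi> t r * c r) t"
      and xi_q: "L2_past_sums M (\<lambda>r \<omega>. xi_q p q \<phi> \<theta> t r * \<epsilon> r \<omega>) t
            (\<lambda>\<omega>. y t \<omega> - past_sum (\<lambda>r. xi p \<phi> t r * c r) t)"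
      unfolding has_past_representation_def by blast+
    show "((\<lambda>s. xi p \<phi> t s * c s) \<longlongrightarrow> 0) at_bot"
      using xi by (rule past_summable_tendsto_zero)
    show "((\<lambda>s. (xi_q p q \<phi> \<theta> t s)\<^sup>2 * (\<sigma> s)\<^sup>2) \<longlongrightarrow> 0) at_bot"
      using xi_q by (rule terms_tendsto_zero)
  next
    fix t
    assume "\<forall>t. past_summable (\<lambda>r. xi p \<phi> t r * c r) t"
    then show "((\<lambda>s. xi p \<phi> t s * c s) \<longlongrightarrow> 0) at_bot"
      by (intro past_summable_tendsto_zero[of _ t]) (rule spec)
  next
    fix t
    assume "\<forall>t. \<exists>Z. L2_past_sums M (\<lambda>r \<omega>. xi_q p q \<phi> \<theta> t r * \<epsilon> r \<omega>) t Z"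
    then obtain Z where "L2_past_sums M (\<lambda>r \<omega>. xi_q p q \<phi> \<theta> t r * \<epsilon> r \<omega>) t Z" by blast
    then show "((\<lambda>s. (xi_q p q \<phi> \<theta> t s)\<^sup>2 * (\<sigma> s)\<^sup>2) \<longlongrightarrow> 0) at_bot"
      by (rule terms_tendsto_zero)
  next
    fix t
    assume "bounded (range c) \<and> (\<forall>l\<in>{1..q}. bounded (range (\<theta> l))) \<and>
      (\<forall>t. ((\<lambda>s. xi p \<phi> t s) \<longlongrightarrow> 0) at_bot)"
    then have xi: "(xi p \<phi> t \<longlongrightarrow> 0) at_bot"
      and c: "bounded (range c)" and \<theta>: "\<forall>l\<in>{1..q}. bounded (range (\<theta> l))" by blast+
    show "((\<lambda>s. xi p \<phi> t s * c s) \<longlongrightarrow> 0) at_bot"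
      using xi c by (rule bounded_mult_tendsto_zero)
    have "(xi_q p q \<phi> \<theta> t \<longlongrightarrow> 0) at_bot"
      using xi \<theta> by (rule xi_q_tendsto_zero)
    from tendsto_power[OF this, of 2]
    have "((\<lambda>s. (xi_q p q \<phi> \<theta> t s)\<^sup>2) \<longlongrightarrow> 0) at_bot" by simp
    then show "((\<lambda>s. (xi_q p q \<phi> \<theta> t s)\<^sup>2 * (\<sigma> s)\<^sup>2) \<longlongrightarrow> 0) at_bot"
      using errors_variance_bounded[OF e] by (rule bounded_mult_tendsto_zero)
  next
    fix t
    assume "\<forall>t. past_summable (\<lambda>r. \<bar>xi p \<phi> t r\<bar>) t"
    then have "((\<lambda>s. \<bar>xi p \<phi> t s\<bar>) \<longlongrightarrow> 0) at_bot"
      by (intro past_summable_tendsto_zero[of _ t]) (rule spec)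
    then show "((\<lambda>s. xi p \<phi> t s) \<longlongrightarrow> 0) at_bot"
      by (rule tendsto_rabs_zero_cancel)
  qed
qed

end
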